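(* Let $R$ be a ring, $\sigma$ an automorphism of $R$, $\delta$ a locally nilpotent $\sigma$-derivation of $R$, and $A=R(x;\sigma,\delta)$ the skew Ore polynomial ring. Let $M_R$ be a right $R$-module. If $M_R$ is completely $(\sigma,\delta)$-compatible, then $$\mathrm{rudim}(M[x^{-1}]_A)=\mathrm{rudim}(M_R)$$ (as elements of $\mathbb N\cup\{\infty\}$).
   Context: Rings are associative with identity, not necessarily commutative; modules are right modules. A $\sigma$-derivation of $R$ is an additive map $\delta:R\to R$ with $\delta(rs)=\sigma(r)\delta(s)+\delta(r)s$ for all $r,s\in R$. It is locally nilpotent if for every $r\in R$ there is $n(r)\ge 1$ with $\delta^{n(r)}(r)=0$. Skew Ore polynomial ring: $A=R(x;\sigma,\delta)$ is the (associative) ring containing $R$ and an element $x$, whose elements are uniquely representable as $r_0+r_1x+\cdots+r_kx^k$ with $r_i\in R$, $k\in\mathbb N$, and with commutation rule $xr=\sigma(r)x+x\delta(r)x$ for all $r\in R$; equivalently $xr=\sigma(r)x+\sigma\delta(r)x^2+\cdots+\sigma\delta^{n(r)-1}(r)x^{n(r)}$. That these data define such a ring $A$ is part of the setting. Inverse polynomial module: put $\sigma'=\sigma^{-1}$ and $\delta'=-\delta\sigma^{-1}$. For $0\le i\le k$ let $f_k^i:R\to R$ be the sum of all words (compositions) in $\sigma',\delta'$ with $i$ letters $\sigma'$ and $k-i$ letters $\delta'$ ($f_0^0=\mathrm{id}$). For a right $R$-module $M_R$, $M[x^{-1}]$ is the additive group of formal polynomials $m_0+m_1x^{-1}+\cdots+m_kx^{-k}$,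 $m_i\in M$, $k\in\mathbb N$. It is a right $A$-module via $(mx^{-k})r=\sum_{i=0}^k m f_k^i(r)x^{-i}$ for $r\in R$ (the iteration of $mx^{-1}r=m\sigma'(r)x^{-1}+m\delta'(r)$) and $(mx^{-i})x^j=mx^{-i+j}$ if $j\le i$ and $0$ if $j>i$. Compatibility: a module $L_R$ is $\sigma$-compatible if for all $l\in L$, $r\in R$: $lr=0\iff l\sigma(r)=0$; it is $\delta$-compatible if $lr=0$ implies $l\delta(r)=0$. $M_R$ is completely $(\sigma,\delta)$-compatible if for every submodule $N_R\subseteq M_R$ the quotient $(M/N)_R$ is both $\sigma$-compatible and $\delta$-compatible. Uniform dimension: a non-zero module is uniform if any two of its non-zero submodules have non-zero intersection. A submodule $N$ of $M$ is essential if $mR\cap N\ne0$ for every non-zero $m\in M$. The (right) uniform dimension $\mathrm{rudim}(M_R)$ equals $n$ if there are uniform submodules $U_1,\dots,U_n$ of $M$ whose sum is direct and essential in $M$; it is $\infty$ if no such $n$ exists, equivalently if $M$ contains an infinite direct sum of non-zero submodules. *)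

theory Defs
  imports "HOL-Algebra.UnivPoly" "HOL-Algebra.QuotRing" "HOL-Library.Extended_Nat"
begin

section \<open>Right modules\<close>

text \<open>The locale \<^locale>\<open>module\<close> requires a commutative base ring, so right modules over arbitrary
  rings are introduced here. As for the record of the library's modules, the multiplicative fields
  inherited from the ring record are not used.\<close>

record ('r, 'm) rmodule = "'m ring" +
  act :: "['m, 'r] \<Rightarrow> 'm"  (infixl \<open>\<triangleleft>\<index>\<close> 70)

locale right_module = R?: ring R + M?: abelian_group M
  for R :: "('r, 'p) ring_scheme" (structure) and M :: "('r, 'm, 's) rmodule_scheme" (structure) +
  assumes act_closed: "\<lbrakk>m \<in> carrier M; r \<in> carrier R\<rbrakk> \<Longrightarrow> m \<triangleleft>\<^bsub>M\<^esub> r \<in> carrier M"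
    and act_l_distr: "\<lbrakk>m \<in> carrier M; n \<in> carrier M; r \<in> carrier R\<rbrakk>
      \<Longrightarrow> (m \<oplus>\<^bsub>M\<^esub> n) \<triangleleft>\<^bsub>M\<^esub> r = m \<triangleleft>\<^bsub>M\<^esub> r \<oplus>\<^bsub>M\<^esub> n \<triangleleft>\<^bsub>M\<^esub> r"
    and act_r_distr: "\<lbrakk>m \<in> carrier M; r \<in> carrier R; s \<in> carrier R\<rbrakk>
      \<Longrightarrow> m \<triangleleft>\<^bsub>M\<^esub> (r \<oplus>\<^bsub>R\<^esub> s) = m \<triangleleft>\<^bsub>M\<^esub> r \<oplus>\<^bsub>M\<^esub> m \<triangleleft>\<^bsub>M\<^esub> s"
    and act_assoc: "\<lbrakk>m \<in> carrier M; r \<in> carrier R; s \<in> carrier R\<rbrakk>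
      \<Longrightarrow> m \<triangleleft>\<^bsub>M\<^esub> (r \<otimes>\<^bsub>R\<^esub> s) = (m \<triangleleft>\<^bsub>M\<^esub> r) \<triangleleft>\<^bsub>M\<^esub> s"
    and act_one: "m \<in> carrier M \<Longrightarrow> m \<triangleleft>\<^bsub>M\<^esub> \<one>\<^bsub>R\<^esub> = m"

definition rsubmodule ::
  "('r, 'p) ring_scheme \<Rightarrow> ('r, 'm, 's) rmodule_scheme \<Rightarrow> 'm set \<Rightarrow> bool" where
  "rsubmodule R M N \<longleftrightarrow>
     additive_subgroup N M \<and> (\<forall>m\<in>N. \<forall>r\<in>carrier R. m \<triangleleft>\<^bsub>M\<^esub> r \<in> N)"

text \<open>In the action on cosets the union over representatives is the single coset \<open>N + mr\<close> whenever
  \<open>N\<close> is a submodule.\<close>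

definition rquot :: "('r, 'm, 's) rmodule_scheme \<Rightarrow> 'm set \<Rightarrow> ('r, 'm set) rmodule" where
  "rquot M N = \<lparr>carrier = a_rcosets\<^bsub>M\<^esub> N, mult = undefined, one = undefined,
     zero = N, add = set_add M,
     act = (\<lambda>C r. \<Union>m\<in>C. N +>\<^bsub>M\<^esub> (m \<triangleleft>\<^bsub>M\<^esub> r))\<rparr>"


section \<open>Uniform dimension\<close>

definition uniform_rmodule ::
  "('r, 'p) ring_scheme \<Rightarrow> ('r, 'm, 's) rmodule_scheme \<Rightarrow> bool" where
  "uniform_rmodule R M \<longleftrightarrow> carrier M \<noteq> {\<zero>\<^bsub>M\<^esub>} \<and>
     (\<forall>N1 N2. rsubmodule R M N1 \<and> rsubmodule R M N2 \<and> N1 \<noteq> {\<zero>\<^bsub>M\<^esub>} \<and> N2 \<noteq> {\<zero>\<^bsub>M\<^esub>}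
        \<longrightarrow> N1 \<inter> N2 \<noteq> {\<zero>\<^bsub>M\<^esub>})"

definition essential_rsubmodule ::
  "('r, 'p) ring_scheme \<Rightarrow> ('r, 'm, 's) rmodule_scheme \<Rightarrow> 'm set \<Rightarrow> bool" where
  "essential_rsubmodule R M N \<longleftrightarrow> rsubmodule R M N \<and>
     (\<forall>m\<in>carrier M. m \<noteq> \<zero>\<^bsub>M\<^esub> \<longrightarrow> {m \<triangleleft>\<^bsub>M\<^esub> r |r. r \<in> carrier R} \<inter> N \<noteq> {\<zero>\<^bsub>M\<^esub>})"

definition family_sum ::
  "('r, 'm, 's) rmodule_scheme \<Rightarrow> nat \<Rightarrow> (nat \<Rightarrow> 'm set) \<Rightarrow> 'm set" where
  "family_sum M n U = {\<Oplus>\<^bsub>M\<^esub>i\<in>{..<n}. u i |u. \<forall>i<n. u i \<in> U i}"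

definition family_direct ::
  "('r, 'm, 's) rmodule_scheme \<Rightarrow> nat \<Rightarrow> (nat \<Rightarrow> 'm set) \<Rightarrow> bool" where
  "family_direct M n U \<longleftrightarrow>
     (\<forall>u. (\<forall>i<n. u i \<in> U i) \<and> (\<Oplus>\<^bsub>M\<^esub>i\<in>{..<n}. u i) = \<zero>\<^bsub>M\<^esub> \<longrightarrow> (\<forall>i<n. u i = \<zero>\<^bsub>M\<^esub>))"

definition has_rudim ::
  "('r, 'p) ring_scheme \<Rightarrow> ('r, 'm, 's) rmodule_scheme \<Rightarrow> nat \<Rightarrow> bool" where
  "has_rudim R M n \<longleftrightarrow> (\<exists>U.
     (\<forall>i<n. rsubmodule R M (U i) \<and> uniform_rmodule R (M\<lparr>carrier := U i\<rparr>)) \<and>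
     family_direct M n U \<and> essential_rsubmodule R M (family_sum M n U))"

text \<open>For right modules the number \<open>n\<close> below is unique by the classical theorem of Goldie.\<close>

definition rudim :: "('r, 'p) ring_scheme \<Rightarrow> ('r, 'm, 's) rmodule_scheme \<Rightarrow> enat" where
  "rudim R M = (if \<exists>n. has_rudim R M n then enat (THE n. has_rudim R M n) else \<infinity>)"


section \<open>Skew Ore polynomial rings\<close>

definition sigma_derivation ::
  "('r, 'p) ring_scheme \<Rightarrow> ('r \<Rightarrow> 'r) \<Rightarrow> ('r \<Rightarrow> 'r) \<Rightarrow> bool" where
  "sigma_derivation R \<sigma> \<delta> \<longleftrightarrow> \<delta> \<in> carrier R \<rightarrow> carrier R \<and>
     (\<forall>r\<in>carrier R. \<forall>s\<in>carrier R.
        \<delta> (r \<oplus>\<^bsub>R\<^esub> s) = \<delta> r \<oplus>\<^bsub>R\<^esub> \<delta> s \<and>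
        \<delta> (r \<otimes>\<^bsub>R\<^esub> s) = \<sigma> r \<otimes>\<^bsub>R\<^esub> \<delta> s \<oplus>\<^bsub>R\<^esub> \<delta> r \<otimes>\<^bsub>R\<^esub> s)"

definition locally_nilpotent :: "('r, 'p) ring_scheme \<Rightarrow> ('r \<Rightarrow> 'r) \<Rightarrow> bool" where
  "locally_nilpotent R \<delta> \<longleftrightarrow> (\<forall>r\<in>carrier R. \<exists>n\<ge>1. (\<delta> ^^ n) r = \<zero>\<^bsub>R\<^esub>)"

text \<open>\<open>\<Sum> \<iota>(c\<^sub>j) x\<^sup>j\<close> for a finitely supported sequence \<open>c\<close> of coefficients in \<open>R\<close>; the inclusion of
  \<open>R\<close> into \<open>A\<close> is the map \<open>\<iota>\<close>.\<close>

definition ore_poly ::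
  "('r, 'p) ring_scheme \<Rightarrow> ('a, 'q) ring_scheme \<Rightarrow> ('r \<Rightarrow> 'a) \<Rightarrow> 'a \<Rightarrow> (nat \<Rightarrow> 'r) \<Rightarrow> 'a" where
  "ore_poly R A \<iota> x c =
     (\<Oplus>\<^bsub>A\<^esub>j\<in>{j. c j \<noteq> \<zero>\<^bsub>R\<^esub>}. \<iota> (c j) \<otimes>\<^bsub>A\<^esub> (x [^]\<^bsub>A\<^esub> (j::nat)))"

text \<open>\<open>A = R(x;\<sigma>,\<delta>)\<close>. Injectivity of \<open>\<iota>\<close> follows from uniqueness of the coefficients. Such a ring
  need not exist for every \<open>\<sigma>\<close> and \<open>\<delta>\<close>; its existence is part of the predicate.\<close>

definition skew_ore_ring ::
  "('r, 'p) ring_scheme \<Rightarrow> ('r \<Rightarrow> 'r) \<Rightarrow> ('r \<Rightarrow> 'r) \<Rightarrow> ('a, 'q) ring_scheme \<Rightarrow> ('r \<Rightarrow> 'a) \<Rightarrow> 'a \<Rightarrow> bool"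
  where
  "skew_ore_ring R \<sigma> \<delta> A \<iota> x \<longleftrightarrow>
     ring A \<and> \<iota> \<in> ring_hom R A \<and> x \<in> carrier A \<and>
     (\<forall>a\<in>carrier A. \<exists>!c. c \<in> up R \<and> a = ore_poly R A \<iota> x c) \<and>
     (\<forall>r\<in>carrier R. x \<otimes>\<^bsub>A\<^esub> \<iota> r = \<iota> (\<sigma> r) \<otimes>\<^bsub>A\<^esub> x \<oplus>\<^bsub>A\<^esub> x \<otimes>\<^bsub>A\<^esub> \<iota> (\<delta> r) \<otimes>\<^bsub>A\<^esub> x)"

definition ore_coeffs ::
  "('r, 'p) ring_scheme \<Rightarrow> ('a, 'q) ring_scheme \<Rightarrow> ('r \<Rightarrow> 'a) \<Rightarrow> 'a \<Rightarrow> 'a \<Rightarrow> nat \<Rightarrow> 'r" where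
  "ore_coeffs R A \<iota> x a = (THE c. c \<in> up R \<and> a = ore_poly R A \<iota> x c)"


section \<open>Inverse polynomial modules\<close>

definition sigma' :: "('r, 'p) ring_scheme \<Rightarrow> ('r \<Rightarrow> 'r) \<Rightarrow> 'r \<Rightarrow> 'r" where
  "sigma' R \<sigma> = inv_into (carrier R) \<sigma>"

definition delta' :: "('r, 'p) ring_scheme \<Rightarrow> ('r \<Rightarrow> 'r) \<Rightarrow> ('r \<Rightarrow> 'r) \<Rightarrow> 'r \<Rightarrow> 'r" where
  "delta' R \<sigma> \<delta> r = \<ominus>\<^bsub>R\<^esub> \<delta> (sigma' R \<sigma> r)"

text \<open>A word in two letters is a list of Booleans, \<open>True\<close> standing for the first letter.\<close>

primrec word_map :: "('r \<Rightarrow> 'r) \<Rightarrow> ('r \<Rightarrow> 'r) \<Rightarrow> bool list \<Rightarrow> 'r \<Rightarrow> 'r" where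
  "word_map s d [] = id"
| "word_map s d (b # w) = (if b then s else d) \<circ> word_map s d w"

definition word_sum ::
  "('r, 'p) ring_scheme \<Rightarrow> ('r \<Rightarrow> 'r) \<Rightarrow> ('r \<Rightarrow> 'r) \<Rightarrow> nat \<Rightarrow> nat \<Rightarrow> 'r \<Rightarrow> 'r" where
  "word_sum R \<sigma> \<delta> k i r =
     (\<Oplus>\<^bsub>R\<^esub>w\<in>{w. length w = k \<and> count_list w True = i}.
        word_map (sigma' R \<sigma>) (delta' R \<sigma> \<delta>) w r)"

text \<open>An inverse polynomial \<open>\<Sum> m\<^sub>k x\<^sup>-\<^sup>k\<close> is the finitely supported sequence \<open>k \<mapsto> m\<^sub>k\<close>.\<close>

definition inv_poly_scalar ::
  "('r, 'p) ring_scheme \<Rightarrow> ('r \<Rightarrow> 'r) \<Rightarrow> ('r \<Rightarrow> 'r) \<Rightarrow> ('r, 'm, 's) rmodule_scheme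
     \<Rightarrow> (nat \<Rightarrow> 'm) \<Rightarrow> 'r \<Rightarrow> nat \<Rightarrow> 'm" where
  "inv_poly_scalar R \<sigma> \<delta> M v r =
     (\<lambda>i. \<Oplus>\<^bsub>M\<^esub>k\<in>{k. i \<le> k \<and> v k \<noteq> \<zero>\<^bsub>M\<^esub>}. v k \<triangleleft>\<^bsub>M\<^esub> word_sum R \<sigma> \<delta> k i r)"

definition inv_poly_shift :: "(nat \<Rightarrow> 'm) \<Rightarrow> nat \<Rightarrow> nat \<Rightarrow> 'm" where
  "inv_poly_shift v j = (\<lambda>i. v (i + j))"

text \<open>The action of \<open>a = \<Sum> r\<^sub>j x\<^sup>j\<close> is \<open>v a = \<Sum> (v r\<^sub>j) x\<^sup>j\<close>, computed coefficientwise.\<close>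

definition inv_poly_module ::
  "('r, 'p) ring_scheme \<Rightarrow> ('r \<Rightarrow> 'r) \<Rightarrow> ('r \<Rightarrow> 'r) \<Rightarrow> ('a, 'q) ring_scheme \<Rightarrow> ('r \<Rightarrow> 'a) \<Rightarrow> 'a
     \<Rightarrow> ('r, 'm, 's) rmodule_scheme \<Rightarrow> ('a, nat \<Rightarrow> 'm) rmodule" where
  "inv_poly_module R \<sigma> \<delta> A \<iota> x M =
     \<lparr>carrier = up M, mult = undefined, one = undefined,
      zero = (\<lambda>i. \<zero>\<^bsub>M\<^esub>), add = (\<lambda>v w i. v i \<oplus>\<^bsub>M\<^esub> w i),
      act = (\<lambda>v a i. let c = ore_coeffs R A \<iota> x a in
        \<Oplus>\<^bsub>M\<^esub>j\<in>{j. c j \<noteq> \<zero>\<^bsub>R\<^esub>}.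
          inv_poly_shift (inv_poly_scalar R \<sigma> \<delta> M v (c j)) j i)\<rparr>"


section \<open>Compatibility\<close>

definition sigma_compatible ::
  "('r, 'p) ring_scheme \<Rightarrow> ('r \<Rightarrow> 'r) \<Rightarrow> ('r, 'm, 's) rmodule_scheme \<Rightarrow> bool" where
  "sigma_compatible R \<sigma> L \<longleftrightarrow>
     (\<forall>l\<in>carrier L. \<forall>r\<in>carrier R. l \<triangleleft>\<^bsub>L\<^esub> r = \<zero>\<^bsub>L\<^esub> \<longleftrightarrow> l \<triangleleft>\<^bsub>L\<^esub> \<sigma> r = \<zero>\<^bsub>L\<^esub>)"

definition delta_compatible ::
  "('r, 'p) ring_scheme \<Rightarrow> ('r \<Rightarrow> 'r) \<Rightarrow> ('r, 'm, 's) rmodule_scheme \<Rightarrow> bool" where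
  "delta_compatible R \<delta> L \<longleftrightarrow>
     (\<forall>l\<in>carrier L. \<forall>r\<in>carrier R. l \<triangleleft>\<^bsub>L\<^esub> r = \<zero>\<^bsub>L\<^esub> \<longrightarrow> l \<triangleleft>\<^bsub>L\<^esub> \<delta> r = \<zero>\<^bsub>L\<^esub>)"

definition completely_compatible ::
  "('r, 'p) ring_scheme \<Rightarrow> ('r \<Rightarrow> 'r) \<Rightarrow> ('r \<Rightarrow> 'r) \<Rightarrow> ('r, 'm, 's) rmodule_scheme \<Rightarrow> bool" where
  "completely_compatible R \<sigma> \<delta> M \<longleftrightarrow>
     (\<forall>N. rsubmodule R M N \<longrightarrow>
        sigma_compatible R \<sigma> (rquot M N) \<and> delta_compatible R \<delta> (rquot M N))"

end

(*
  The constants m form an A-submodule of M[x^-1], namely the annihilator of x, on which A acts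
  through R by the constant coefficient. If v has top coefficient m in degree k, then
  v (s x^k) = m (sigma^-k s), so the orbit vA contains the constants mR; hence the constants meet
  every non-zero submodule. Families of uniform submodules with direct essential sum are therefore transported
  from M by taking images, and from M[x^-1] by intersecting with the constants: if a constant lies
  in a direct sum of submodules, x annihilates it and so annihilates each of its components.
  This matches the numbers n in the definition of the uniform dimension on both sides, without
  appeal to their uniqueness.
*)

theory Submission
  imports Defs
begin

section \<open>Submodules\<close>

lemma rsubmoduleI:
  assumes "abelian_group M" "N \<subseteq> carrier M" "\<zero>\<^bsub>M\<^esub> \<in> N"
    and "\<And>m n. \<lbrakk>m \<in> N; n \<in> N\<rbrakk> \<Longrightarrow> m \<oplus>\<^bsub>M\<^esub> n \<in> N"
    and "\<And>m. m \<in> N \<Longrightarrow> \<ominus>\<^bsub>M\<^esub> m \<in> N"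
    and "\<And>m r. \<lbrakk>m \<in> N; r \<in> carrier R\<rbrakk> \<Longrightarrow> m \<triangleleft>\<^bsub>M\<^esub> r \<in> N"
  shows "rsubmodule R M N"
proof -
  interpret M: abelian_group M by fact
  have "subgroup N (add_monoid M)"
    using assms by (intro M.add.subgroupI) (auto simp: a_inv_def)
  then show ?thesis
    using assms(6) by (simp add: rsubmodule_def additive_subgroup_def)
qed

lemma rsubmoduleD:
  assumes "rsubmodule R M N"
  shows "N \<subseteq> carrier M" "\<zero>\<^bsub>M\<^esub> \<in> N"
    and "\<lbrakk>m \<in> N; n \<in> N\<rbrakk> \<Longrightarrow> m \<oplus>\<^bsub>M\<^esub> n \<in> N"
    and "\<lbrakk>m \<in> N; r \<in> carrier R\<rbrakk> \<Longrightarrow> m \<triangleleft>\<^bsub>M\<^esub> r \<in> N"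
  using assms additive_subgroup.a_subset[of N M] additive_subgroup.zero_closed[of N M]
    additive_subgroup.a_closed[of N M]
  by (auto simp: rsubmodule_def)

lemma rsubmodule_a_inv:
  assumes "abelian_group M" "rsubmodule R M N" "m \<in> N"
  shows "\<ominus>\<^bsub>M\<^esub> m \<in> N"
proof -
  interpret M: abelian_group M by fact
  have "subgroup N (add_monoid M)"
    using assms(2) by (simp add: rsubmodule_def additive_subgroup_def)
  then show ?thesis
    using subgroup.m_inv_closed[OF _ assms(3)] by (simp add: a_inv_def)
qed

lemma rsubmodule_restrict_iff:
  assumes "abelian_group M" "rsubmodule R M U"
  shows "rsubmodule R (M\<lparr>carrier := U\<rparr>) N \<longleftrightarrow> rsubmodule R M N \<and> N \<subseteq> U"
proof -
  interpret M: abelian_group M by fact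
  have U: "subgroup U (add_monoid M)"
    using assms by (simp add: rsubmodule_def additive_subgroup_def)
  have "subgroup N (add_monoid (M\<lparr>carrier := U\<rparr>)) \<longleftrightarrow> subgroup N (add_monoid M) \<and> N \<subseteq> U"
    using M.add.incl_subgroup[OF U, of N] M.add.subgroup_incl[OF _ U, of N]
      subgroup.subset[of N "add_monoid (M\<lparr>carrier := U\<rparr>)"]
    by simp blast
  then show ?thesis
    by (simp add: rsubmodule_def additive_subgroup_def conj_ac)
qed

lemma uniform_rsubmodule_iff:
  assumes "abelian_group M" "rsubmodule R M U"
  shows "uniform_rmodule R (M\<lparr>carrier := U\<rparr>) \<longleftrightarrow> U \<noteq> {\<zero>\<^bsub>M\<^esub>} \<and>
    (\<forall>N1 N2. rsubmodule R M N1 \<and> rsubmodule R M N2 \<and> N1 \<subseteq> U \<and> N2 \<subseteq> U \<and>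
      N1 \<noteq> {\<zero>\<^bsub>M\<^esub>} \<and> N2 \<noteq> {\<zero>\<^bsub>M\<^esub>} \<longrightarrow> N1 \<inter> N2 \<noteq> {\<zero>\<^bsub>M\<^esub>})"
  unfolding uniform_rmodule_def by (simp add: rsubmodule_restrict_iff[OF assms] conj_ac)

lemma family_sumI:
  "(\<And>i. i < n \<Longrightarrow> u i \<in> U i) \<Longrightarrow> (\<Oplus>\<^bsub>M\<^esub>i\<in>{..<n}. u i) \<in> family_sum M n U"
  unfolding family_sum_def by blast

lemma family_directI:
  assumes "\<And>u i. \<lbrakk>\<And>j. j < n \<Longrightarrow> u j \<in> U j; (\<Oplus>\<^bsub>M\<^esub>j\<in>{..<n}. u j) = \<zero>\<^bsub>M\<^esub>; i < n\<rbrakk> \<Longrightarrow> u i = \<zero>\<^bsub>M\<^esub>"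
  shows "family_direct M n U"
  using assms unfolding family_direct_def by blast

lemma family_directD:
  assumes "family_direct M n U" "\<And>j. j < n \<Longrightarrow> u j \<in> U j" "(\<Oplus>\<^bsub>M\<^esub>j\<in>{..<n}. u j) = \<zero>\<^bsub>M\<^esub>" "i < n"
  shows "u i = \<zero>\<^bsub>M\<^esub>"
  using assms unfolding family_direct_def by blast

lemma family_direct_mono:
  assumes "family_direct M n W" "\<And>i. i < n \<Longrightarrow> U i \<subseteq> W i"
  shows "family_direct M n U"
proof (rule family_directI)
  fix u i assume "\<And>j. j < n \<Longrightarrow> u j \<in> U j" "(\<Oplus>\<^bsub>M\<^esub>j\<in>{..<n}. u j) = \<zero>\<^bsub>M\<^esub>" "i < n"
  then show "u i = \<zero>\<^bsub>M\<^esub>"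
    using assms(2) by (intro family_directD[OF assms(1), of u]) auto
qed

lemma (in right_module) act_zero:
  assumes "m \<in> carrier M"
  shows "m \<triangleleft>\<^bsub>M\<^esub> \<zero>\<^bsub>R\<^esub> = \<zero>\<^bsub>M\<^esub>"
proof -
  have "m \<triangleleft>\<^bsub>M\<^esub> \<zero>\<^bsub>R\<^esub> \<oplus>\<^bsub>M\<^esub> m \<triangleleft>\<^bsub>M\<^esub> \<zero>\<^bsub>R\<^esub> = m \<triangleleft>\<^bsub>M\<^esub> \<zero>\<^bsub>R\<^esub>"
    using act_r_distr[OF assms, of "\<zero>\<^bsub>R\<^esub>" "\<zero>\<^bsub>R\<^esub>"] by simp
  then show ?thesis
    using M.add.l_cancel_one act_closed assms by simp
qed

lemma (in right_module) zero_act: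
  assumes "r \<in> carrier R"
  shows "\<zero>\<^bsub>M\<^esub> \<triangleleft>\<^bsub>M\<^esub> r = \<zero>\<^bsub>M\<^esub>"
proof -
  have "\<zero>\<^bsub>M\<^esub> \<triangleleft>\<^bsub>M\<^esub> r \<oplus>\<^bsub>M\<^esub> \<zero>\<^bsub>M\<^esub> \<triangleleft>\<^bsub>M\<^esub> r = \<zero>\<^bsub>M\<^esub> \<triangleleft>\<^bsub>M\<^esub> r"
    using act_l_distr[of "\<zero>\<^bsub>M\<^esub>" "\<zero>\<^bsub>M\<^esub>" r] assms by simp
  then show ?thesis
    using M.add.l_cancel_one act_closed assms by simp
qed


lemma (in abelian_group_hom) hom_finsum:
  "f \<in> I \<rightarrow> carrier G \<Longrightarrow> h (finsum G f I) = finsum H (h \<circ> f) I"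
  by (induct I rule: infinite_finite_induct) (auto simp: Pi_def)


section \<open>Uniform dimension along an essential embedding\<close>

text \<open>Only additivity of the action of the single element \<open>X\<close> on \<open>V\<close> is required, so that \<open>V\<close> need
  not be known to be an \<open>A\<close>-module.\<close>

locale essential_embedding =
  right_module R M + e: abelian_group_hom M V e + X: abelian_group_hom V V "\<lambda>v. v \<triangleleft>\<^bsub>V\<^esub> X"
  for R :: "('r, 'p) ring_scheme" and M :: "('r, 'm, 's) rmodule_scheme"
    and A :: "('a, 'q) ring_scheme" and V :: "('a, 'v, 't) rmodule_scheme"
    and e :: "'m \<Rightarrow> 'v" and X :: 'a +
  assumes inj_e: "inj_on e (carrier M)"
    and X_closed: "X \<in> carrier A"
    and orbit_e: "m \<in> carrier M \<Longrightarrow>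
      (\<lambda>a. e m \<triangleleft>\<^bsub>V\<^esub> a) ` carrier A = (\<lambda>r. e (m \<triangleleft>\<^bsub>M\<^esub> r)) ` carrier R"
    and orbit_meets: "\<lbrakk>v \<in> carrier V; v \<noteq> \<zero>\<^bsub>V\<^esub>\<rbrakk> \<Longrightarrow>
      \<exists>m\<in>carrier M. m \<noteq> \<zero>\<^bsub>M\<^esub> \<and> (\<forall>r\<in>carrier R. \<exists>a\<in>carrier A. v \<triangleleft>\<^bsub>V\<^esub> a = e (m \<triangleleft>\<^bsub>M\<^esub> r))"
    and kernel_X: "\<lbrakk>v \<in> carrier V; v \<triangleleft>\<^bsub>V\<^esub> X = \<zero>\<^bsub>V\<^esub>\<rbrakk> \<Longrightarrow> v \<in> e ` carrier M"
    and X_e: "m \<in> carrier M \<Longrightarrow> e m \<triangleleft>\<^bsub>V\<^esub> X = \<zero>\<^bsub>V\<^esub>"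
begin

abbreviation pre :: "'v set \<Rightarrow> 'm set" where
  "pre W \<equiv> {m \<in> carrier M. e m \<in> W}"

lemma e_eq_zero_iff: "m \<in> carrier M \<Longrightarrow> e m = \<zero>\<^bsub>V\<^esub> \<longleftrightarrow> m = \<zero>\<^bsub>M\<^esub>"
  using inj_onD[OF inj_e] e.hom_zero M.zero_closed by metis

lemma rsubmodule_pre:
  assumes "rsubmodule A V W"
  shows "rsubmodule R M (pre W)"
proof (rule rsubmoduleI)
  fix m r assume m: "m \<in> pre W" and r: "r \<in> carrier R"
  then obtain a where "a \<in> carrier A" "e (m \<triangleleft>\<^bsub>M\<^esub> r) = e m \<triangleleft>\<^bsub>V\<^esub> a"
    using orbit_e[of m] by (smt (verit) image_iff mem_Collect_eq)
  then show "m \<triangleleft>\<^bsub>M\<^esub> r \<in> pre W"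
    using m r act_closed rsubmoduleD(4)[OF assms] by auto
qed (use M.abelian_group_axioms rsubmoduleD[OF assms]
    rsubmodule_a_inv[OF e.H.abelian_group_axioms assms] in auto)

lemma rsubmodule_image:
  assumes "rsubmodule R M N"
  shows "rsubmodule A V (e ` N)"
proof (rule rsubmoduleI)
  note N = rsubmoduleD[OF assms] rsubmodule_a_inv[OF M.abelian_group_axioms assms]
  show "abelian_group V" by (rule e.H.abelian_group_axioms)
  show "e ` N \<subseteq> carrier V" using N(1) by auto
  show "\<zero>\<^bsub>V\<^esub> \<in> e ` N" using imageI[OF N(2), of e] by simp
  fix v assume "v \<in> e ` N"
  then obtain m where m: "m \<in> N" "m \<in> carrier M" "v = e m" using N(1) by auto
  show "\<ominus>\<^bsub>V\<^esub> v \<in> e ` N" using imageI[OF N(5)[OF m(1)], of e] m(2,3) by simp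
  show "v \<triangleleft>\<^bsub>V\<^esub> a \<in> e ` N" if "a \<in> carrier A" for a
  proof -
    have "e m \<triangleleft>\<^bsub>V\<^esub> a \<in> (\<lambda>r. e (m \<triangleleft>\<^bsub>M\<^esub> r)) ` carrier R"
      using orbit_e[OF m(2)] that by blast
    then show ?thesis using N(4) m(1,3) by blast
  qed
  fix w assume "w \<in> e ` N"
  then obtain n where n: "n \<in> N" "n \<in> carrier M" "w = e n" using N(1) by auto
  show "v \<oplus>\<^bsub>V\<^esub> w \<in> e ` N" using imageI[OF N(3)[OF m(1) n(1)], of e] m(2,3) n(2,3) by simp
qed

lemma pre_nonzero:
  assumes "rsubmodule A V W" "W \<noteq> {\<zero>\<^bsub>V\<^esub>}"
  shows "pre W \<noteq> {\<zero>\<^bsub>M\<^esub>}"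
proof -
  obtain v where v: "v \<in> W" "v \<in> carrier V" "v \<noteq> \<zero>\<^bsub>V\<^esub>"
    using assms(2) rsubmoduleD(1,2)[OF assms(1)] by blast
  then obtain m where m: "m \<in> carrier M" "m \<noteq> \<zero>\<^bsub>M\<^esub>"
    and "\<exists>a\<in>carrier A. v \<triangleleft>\<^bsub>V\<^esub> a = e (m \<triangleleft>\<^bsub>M\<^esub> \<one>\<^bsub>R\<^esub>)"
    using orbit_meets R.one_closed by blast
  then obtain a where "a \<in> carrier A" "v \<triangleleft>\<^bsub>V\<^esub> a = e m"
    using act_one by auto
  then have "e m \<in> W"
    using rsubmoduleD(4)[OF assms(1) v(1)] by force
  with m show ?thesis by blast
qed

lemma image_nonzero_iff:
  "N \<subseteq> carrier M \<Longrightarrow> e ` N = {\<zero>\<^bsub>V\<^esub>} \<longleftrightarrow> N = {\<zero>\<^bsub>M\<^esub>}"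
  using inj_on_image_eq_iff[OF inj_e, of N "{\<zero>\<^bsub>M\<^esub>}"] by simp

lemma uniform_image:
  assumes "rsubmodule R M U" "uniform_rmodule R (M\<lparr>carrier := U\<rparr>)"
  shows "uniform_rmodule A (V\<lparr>carrier := e ` U\<rparr>)"
proof -
  note U = rsubmoduleD(1)[OF assms(1)]
  have "N1 \<inter> N2 \<noteq> {\<zero>\<^bsub>V\<^esub>}" if N: "rsubmodule A V N1" "rsubmodule A V N2"
    "N1 \<subseteq> e ` U" "N2 \<subseteq> e ` U" "N1 \<noteq> {\<zero>\<^bsub>V\<^esub>}" "N2 \<noteq> {\<zero>\<^bsub>V\<^esub>}" for N1 N2
  proof -
    have sub: "pre N \<subseteq> U" if "N \<subseteq> e ` U" for N
      using that U inj_onD[OF inj_e] by blast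
    have "pre N1 \<inter> pre N2 \<noteq> {\<zero>\<^bsub>M\<^esub>}"
      using assms N sub rsubmodule_pre pre_nonzero
      by (simp add: uniform_rsubmodule_iff[OF M.abelian_group_axioms assms(1)])
    moreover have "\<zero>\<^bsub>M\<^esub> \<in> pre N1 \<inter> pre N2"
      using N rsubmodule_pre rsubmoduleD(2) by blast
    ultimately obtain m where "m \<in> pre N1 \<inter> pre N2" "m \<noteq> \<zero>\<^bsub>M\<^esub>" by blast
    then show ?thesis using e_eq_zero_iff by auto
  qed
  moreover have "U \<noteq> {\<zero>\<^bsub>M\<^esub>}"
    using assms uniform_rsubmodule_iff[OF M.abelian_group_axioms] by blast
  ultimately show ?thesis
    using image_nonzero_iff[OF U] rsubmodule_image[OF assms(1)]
    by (simp add: uniform_rsubmodule_iff[OF e.H.abelian_group_axioms])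
qed

lemma uniform_pre:
  assumes "rsubmodule A V W" "uniform_rmodule A (V\<lparr>carrier := W\<rparr>)"
  shows "uniform_rmodule R (M\<lparr>carrier := pre W\<rparr>)"
proof -
  have "N1 \<inter> N2 \<noteq> {\<zero>\<^bsub>M\<^esub>}" if N: "rsubmodule R M N1" "rsubmodule R M N2"
    "N1 \<subseteq> pre W" "N2 \<subseteq> pre W" "N1 \<noteq> {\<zero>\<^bsub>M\<^esub>}" "N2 \<noteq> {\<zero>\<^bsub>M\<^esub>}" for N1 N2
  proof -
    have sub: "N1 \<subseteq> carrier M" "N2 \<subseteq> carrier M" "e ` N1 \<subseteq> W" "e ` N2 \<subseteq> W"
      using N by auto
    have "e ` N1 \<inter> e ` N2 \<noteq> {\<zero>\<^bsub>V\<^esub>}"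
      using assms N sub rsubmodule_image image_nonzero_iff
      by (simp add: uniform_rsubmodule_iff[OF e.H.abelian_group_axioms assms(1)])
    then show ?thesis
      using image_nonzero_iff[of "N1 \<inter> N2"] sub(1)
      by (simp add: inj_on_image_Int[OF inj_e sub(1,2)] le_infI1)
  qed
  moreover have "W \<noteq> {\<zero>\<^bsub>V\<^esub>}"
    using assms uniform_rsubmodule_iff[OF e.H.abelian_group_axioms] by blast
  ultimately show ?thesis
    using pre_nonzero[OF assms(1)] rsubmodule_pre[OF assms(1)]
    by (simp add: uniform_rsubmodule_iff[OF M.abelian_group_axioms])
qed

lemma finsum_e:
  fixes n :: nat
  assumes "\<forall>i<n. u i \<in> carrier M"
  shows "(\<Oplus>\<^bsub>V\<^esub>i\<in>{..<n}. e (u i)) = e (\<Oplus>\<^bsub>M\<^esub>i\<in>{..<n}. u i)"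
  using e.hom_finsum[of u "{..<n}"] assms by (simp add: Pi_iff comp_def)

lemma lift_family:
  assumes "\<forall>i<n. w i \<in> e ` U i" "\<forall>i<n. U i \<subseteq> carrier M"
  obtains u where "\<forall>i<n. u i \<in> U i" "\<forall>i<n. w i = e (u i)"
    "(\<Oplus>\<^bsub>V\<^esub>i\<in>{..<n::nat}. w i) = e (\<Oplus>\<^bsub>M\<^esub>i\<in>{..<n}. u i)"
proof -
  obtain u where u: "\<forall>i<n. u i \<in> U i \<and> w i = e (u i)"
    using assms(1) bchoice[of "{..<n}" "\<lambda>i m. m \<in> U i \<and> w i = e m"]
    by (auto simp: image_iff Bex_def)
  then have c: "\<forall>i<n. u i \<in> carrier M"
    using assms(2) by blast
  then have "(\<Oplus>\<^bsub>V\<^esub>i\<in>{..<n}. w i) = (\<Oplus>\<^bsub>V\<^esub>i\<in>{..<n}. e (u i))"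
    using u by (intro e.H.finsum_cong') auto
  also have "\<dots> = e (\<Oplus>\<^bsub>M\<^esub>i\<in>{..<n}. u i)"
    using c by (rule finsum_e)
  finally show thesis using u that by blast
qed

lemma family_sum_image:
  assumes "\<forall>i<n. U i \<subseteq> carrier M"
  shows "family_sum V n (\<lambda>i. e ` U i) = e ` family_sum M n U"
proof (intro equalityI subsetI)
  fix v assume "v \<in> family_sum V n (\<lambda>i. e ` U i)"
  then obtain w where w: "\<forall>i<n. w i \<in> e ` U i" "v = (\<Oplus>\<^bsub>V\<^esub>i\<in>{..<n}. w i)"
    unfolding family_sum_def by blast
  obtain u where "\<forall>i<n. u i \<in> U i" "v = e (\<Oplus>\<^bsub>M\<^esub>i\<in>{..<n}. u i)"
    using lift_family[OF w(1) assms] w(2) by metis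
  then show "v \<in> e ` family_sum M n U"
    unfolding family_sum_def by blast
next
  fix v assume "v \<in> e ` family_sum M n U"
  then obtain u where u: "\<forall>i<n. u i \<in> U i" "v = e (\<Oplus>\<^bsub>M\<^esub>i\<in>{..<n}. u i)"
    unfolding family_sum_def by blast
  then have "v = (\<Oplus>\<^bsub>V\<^esub>i\<in>{..<n}. e (u i))"
    using finsum_e[of n u] assms by (metis subsetD)
  then show "v \<in> family_sum V n (\<lambda>i. e ` U i)"
    unfolding family_sum_def using u(1) by blast
qed

lemma family_direct_image_iff:
  assumes "\<forall>i<n. U i \<subseteq> carrier M"
  shows "family_direct V n (\<lambda>i. e ` U i) \<longleftrightarrow> family_direct M n U"
proof
  assume dir: "family_direct V n (\<lambda>i. e ` U i)"
  show "family_direct M n U"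
  proof (rule family_directI)
    fix u i
    assume u: "\<And>j. j < n \<Longrightarrow> u j \<in> U j" "(\<Oplus>\<^bsub>M\<^esub>j\<in>{..<n}. u j) = \<zero>\<^bsub>M\<^esub>" and i: "i < n"
    have c: "\<forall>j<n. u j \<in> carrier M" using u(1) assms by blast
    have "(\<Oplus>\<^bsub>V\<^esub>j\<in>{..<n}. e (u j)) = \<zero>\<^bsub>V\<^esub>"
      using finsum_e[OF c] u(2) by simp
    then have "e (u i) = \<zero>\<^bsub>V\<^esub>"
      using i u(1) by (intro family_directD[OF dir, of "\<lambda>i. e (u i)"]) auto
    then show "u i = \<zero>\<^bsub>M\<^esub>" using e_eq_zero_iff c i by blast
  qed
next
  assume dir: "family_direct M n U"
  show "family_direct V n (\<lambda>i. e ` U i)"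
  proof (rule family_directI)
    fix w i
    assume w: "\<And>j. j < n \<Longrightarrow> w j \<in> e ` U j" "(\<Oplus>\<^bsub>V\<^esub>j\<in>{..<n}. w j) = \<zero>\<^bsub>V\<^esub>" and i: "i < n"
    obtain u where u: "\<forall>j<n. u j \<in> U j" "\<forall>j<n. w j = e (u j)"
      "(\<Oplus>\<^bsub>V\<^esub>j\<in>{..<n}. w j) = e (\<Oplus>\<^bsub>M\<^esub>j\<in>{..<n}. u j)"
      using lift_family[OF _ assms, of w] w(1) by blast
    have "(\<Oplus>\<^bsub>M\<^esub>j\<in>{..<n}. u j) \<in> carrier M"
      using u(1) assms by (intro M.finsum_closed) auto
    then have "(\<Oplus>\<^bsub>M\<^esub>j\<in>{..<n}. u j) = \<zero>\<^bsub>M\<^esub>"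
      using u(3) w(2) e_eq_zero_iff by metis
    then have "u i = \<zero>\<^bsub>M\<^esub>"
      using u(1) i by (intro family_directD[OF dir, of u]) auto
    then show "w i = \<zero>\<^bsub>V\<^esub>"
      using u(2) i by simp
  qed
qed

text \<open>The components of an element of \<open>e ` carrier M\<close> along a direct family of submodules again lie
  in \<open>e ` carrier M\<close>: they sum to zero after multiplication by \<open>X\<close>.\<close>

lemma family_sum_pre:
  assumes W: "\<forall>i<n. rsubmodule A V (W i)" and dir: "family_direct V n W"
  shows "family_sum M n (\<lambda>i. pre (W i)) = pre (family_sum V n W)"
proof (intro equalityI subsetI)
  fix m assume "m \<in> family_sum M n (\<lambda>i. pre (W i))"
  then obtain u where u: "\<forall>i<n. u i \<in> pre (W i)" "m = (\<Oplus>\<^bsub>M\<^esub>i\<in>{..<n}. u i)"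
    unfolding family_sum_def by blast
  have "e m = (\<Oplus>\<^bsub>V\<^esub>i\<in>{..<n}. e (u i))"
    using finsum_e[of n u] u by simp
  then have "e m \<in> family_sum V n W"
    using family_sumI[of n "\<lambda>i. e (u i)" W V] u(1) by simp
  moreover have "m \<in> carrier M"
    using u by (auto intro!: M.finsum_closed)
  ultimately show "m \<in> pre (family_sum V n W)"
    by simp
next
  fix m assume m: "m \<in> pre (family_sum V n W)"
  then obtain w where w: "\<forall>i<n. w i \<in> W i" "e m = (\<Oplus>\<^bsub>V\<^esub>i\<in>{..<n}. w i)"
    unfolding family_sum_def by blast
  have wV: "w i \<in> carrier V" if "i < n" for i
    using rsubmoduleD(1)[of A V "W i"] W w(1) that by auto
  have "(\<Oplus>\<^bsub>V\<^esub>i\<in>{..<n}. w i \<triangleleft>\<^bsub>V\<^esub> X) = (\<Oplus>\<^bsub>V\<^esub>i\<in>{..<n}. w i) \<triangleleft>\<^bsub>V\<^esub> X"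
    using X.hom_finsum[of w "{..<n}"] wV by (simp add: Pi_iff comp_def)
  also have "\<dots> = \<zero>\<^bsub>V\<^esub>"
    using X_e[of m] m unfolding w(2) by blast
  finally have sum0: "(\<Oplus>\<^bsub>V\<^esub>i\<in>{..<n}. w i \<triangleleft>\<^bsub>V\<^esub> X) = \<zero>\<^bsub>V\<^esub>" .
  have "w i \<in> e ` pre (W i)" if i: "i < n" for i
  proof -
    have "w i \<triangleleft>\<^bsub>V\<^esub> X = \<zero>\<^bsub>V\<^esub>"
    proof (rule family_directD[OF dir _ sum0 i])
      fix j assume "j < n"
      then show "w j \<triangleleft>\<^bsub>V\<^esub> X \<in> W j"
        using rsubmoduleD(4)[of A V "W j" "w j" X] X_closed W w(1) by simp
    qed
    then obtain k where "k \<in> carrier M" "w i = e k"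
      using kernel_X[OF wV[OF i]] by blast
    then show ?thesis
      using w(1) i by auto
  qed
  then have "\<forall>i<n. w i \<in> e ` pre (W i)"
    by simp
  moreover have "\<forall>i<n. pre (W i) \<subseteq> carrier M"
    by blast
  ultimately obtain u where u: "\<forall>i<n. u i \<in> pre (W i)"
    and eu: "(\<Oplus>\<^bsub>V\<^esub>i\<in>{..<n}. w i) = e (\<Oplus>\<^bsub>M\<^esub>i\<in>{..<n}. u i)"
    by (rule lift_family)
  have "(\<Oplus>\<^bsub>M\<^esub>i\<in>{..<n}. u i) \<in> carrier M"
    using u by (auto intro!: M.finsum_closed)
  moreover have "e m = e (\<Oplus>\<^bsub>M\<^esub>i\<in>{..<n}. u i)"
    using w(2) eu by (rule trans)
  ultimately have "m = (\<Oplus>\<^bsub>M\<^esub>i\<in>{..<n}. u i)"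
    using m by (intro inj_onD[OF inj_e]) auto
  then show "m \<in> family_sum M n (\<lambda>i. pre (W i))"
    using family_sumI[of n u "\<lambda>i. pre (W i)" M] u by simp
qed

lemma essential_image:
  assumes "essential_rsubmodule R M N"
  shows "essential_rsubmodule A V (e ` N)"
  unfolding essential_rsubmodule_def
proof (intro conjI ballI impI)
  have N: "rsubmodule R M N" using assms by (simp add: essential_rsubmodule_def)
  then show "rsubmodule A V (e ` N)" by (rule rsubmodule_image)
  fix v assume "v \<in> carrier V" "v \<noteq> \<zero>\<^bsub>V\<^esub>"
  then obtain m where m: "m \<in> carrier M" "m \<noteq> \<zero>\<^bsub>M\<^esub>"
    and a: "\<forall>r\<in>carrier R. \<exists>a\<in>carrier A. v \<triangleleft>\<^bsub>V\<^esub> a = e (m \<triangleleft>\<^bsub>M\<^esub> r)"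
    using orbit_meets by blast
  have "\<zero>\<^bsub>M\<^esub> \<in> {m \<triangleleft>\<^bsub>M\<^esub> r |r. r \<in> carrier R} \<inter> N"
    using act_zero[OF m(1)] rsubmoduleD(2)[OF N] R.zero_closed by force
  then obtain r where r: "r \<in> carrier R" "m \<triangleleft>\<^bsub>M\<^esub> r \<in> N" "m \<triangleleft>\<^bsub>M\<^esub> r \<noteq> \<zero>\<^bsub>M\<^esub>"
    using assms m unfolding essential_rsubmodule_def by blast
  then have "e (m \<triangleleft>\<^bsub>M\<^esub> r) \<in> {v \<triangleleft>\<^bsub>V\<^esub> a |a. a \<in> carrier A} \<inter> e ` N"
    using a by (smt (verit) IntI image_eqI mem_Collect_eq)
  then show "{v \<triangleleft>\<^bsub>V\<^esub> a |a. a \<in> carrier A} \<inter> e ` N \<noteq> {\<zero>\<^bsub>V\<^esub>}"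
    using r(1,3) m(1) act_closed e_eq_zero_iff by blast
qed

lemma essential_pre:
  assumes "essential_rsubmodule A V W"
  shows "essential_rsubmodule R M (pre W)"
  unfolding essential_rsubmodule_def
proof (intro conjI ballI impI)
  have W: "rsubmodule A V W" using assms by (simp add: essential_rsubmodule_def)
  then show "rsubmodule R M (pre W)" by (rule rsubmodule_pre)
  fix m assume m: "m \<in> carrier M" "m \<noteq> \<zero>\<^bsub>M\<^esub>"
  have orbit: "{e m \<triangleleft>\<^bsub>V\<^esub> a |a. a \<in> carrier A} = {e (m \<triangleleft>\<^bsub>M\<^esub> r) |r. r \<in> carrier R}"
    unfolding Setcompr_eq_image by (rule orbit_e[OF m(1)])
  have "e (m \<triangleleft>\<^bsub>M\<^esub> \<zero>\<^bsub>R\<^esub>) = \<zero>\<^bsub>V\<^esub>" using act_zero[OF m(1)] by simp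
  then have "\<zero>\<^bsub>V\<^esub> \<in> {e (m \<triangleleft>\<^bsub>M\<^esub> r) |r. r \<in> carrier R} \<inter> W"
    using rsubmoduleD(2)[OF W] R.zero_closed by force
  moreover have "{e (m \<triangleleft>\<^bsub>M\<^esub> r) |r. r \<in> carrier R} \<inter> W \<noteq> {\<zero>\<^bsub>V\<^esub>}"
    using assms m e_eq_zero_iff unfolding essential_rsubmodule_def orbit[symmetric] by simp
  ultimately obtain r where "r \<in> carrier R" "e (m \<triangleleft>\<^bsub>M\<^esub> r) \<in> W" "e (m \<triangleleft>\<^bsub>M\<^esub> r) \<noteq> \<zero>\<^bsub>V\<^esub>"
    by blast
  then have "m \<triangleleft>\<^bsub>M\<^esub> r \<in> {m \<triangleleft>\<^bsub>M\<^esub> r |r. r \<in> carrier R} \<inter> pre W" "m \<triangleleft>\<^bsub>M\<^esub> r \<noteq> \<zero>\<^bsub>M\<^esub>"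
    using act_closed[OF m(1)] by auto
  then show "{m \<triangleleft>\<^bsub>M\<^esub> r |r. r \<in> carrier R} \<inter> pre W \<noteq> {\<zero>\<^bsub>M\<^esub>}"
    by blast
qed

theorem has_rudim_iff: "has_rudim A V n \<longleftrightarrow> has_rudim R M n"
proof
  assume "has_rudim R M n"
  then obtain U where U: "\<forall>i<n. rsubmodule R M (U i) \<and> uniform_rmodule R (M\<lparr>carrier := U i\<rparr>)"
    "family_direct M n U" "essential_rsubmodule R M (family_sum M n U)"
    unfolding has_rudim_def by blast
  have sub: "\<forall>i<n. U i \<subseteq> carrier M" using U(1) rsubmoduleD(1) by blast
  show "has_rudim A V n"
    unfolding has_rudim_def
    using U(1,2) rsubmodule_image uniform_image essential_image[OF U(3)]
      family_direct_image_iff[OF sub] family_sum_image[OF sub]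
    by (intro exI[of _ "\<lambda>i. e ` U i"]) auto
next
  assume "has_rudim A V n"
  then obtain W where W: "\<forall>i<n. rsubmodule A V (W i) \<and> uniform_rmodule A (V\<lparr>carrier := W i\<rparr>)"
    "family_direct V n W" "essential_rsubmodule A V (family_sum V n W)"
    unfolding has_rudim_def by blast
  have "family_direct V n (\<lambda>i. e ` pre (W i))"
    using W(2) by (rule family_direct_mono) auto
  then have "family_direct M n (\<lambda>i. pre (W i))"
    by (subst (asm) family_direct_image_iff) auto
  then show "has_rudim R M n"
    unfolding has_rudim_def
    using W(1,2) rsubmodule_pre uniform_pre essential_pre[OF W(3)] family_sum_pre[of n W]
    by (intro exI[of _ "\<lambda>i. pre (W i)"]) auto
qed

end


section \<open>Inverse polynomial modules\<close>

lemma count_list_True_eq_length_iff: "count_list w True = length w \<longleftrightarrow> False \<notin> set w"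
proof (induction w)
  case (Cons b w)
  then show ?case using count_le_length[of w True] by auto
qed simp

lemma up_finite:
  assumes "v \<in> up G"
  shows "finite {i. v i \<noteq> \<zero>\<^bsub>G\<^esub>}"
proof -
  obtain n where "bound \<zero>\<^bsub>G\<^esub> n v" using assms by (auto simp: up_def)
  then have "{i. v i \<noteq> \<zero>\<^bsub>G\<^esub>} \<subseteq> {..n}" using bound_below by fastforce
  then show ?thesis by (rule finite_subset) simp
qed

locale inverse_polynomials = right_module R M
  for R :: "('r, 'p) ring_scheme" and M :: "('r, 'm, 's) rmodule_scheme" +
  fixes \<sigma> \<delta> :: "'r \<Rightarrow> 'r" and A :: "('a, 'q) ring_scheme" and \<iota> :: "'r \<Rightarrow> 'a" and x :: 'a
  assumes sigma_iso: "\<sigma> \<in> ring_iso R R"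
    and deriv: "sigma_derivation R \<sigma> \<delta>"
    and ore: "skew_ore_ring R \<sigma> \<delta> A \<iota> x"
begin

abbreviation V :: "('a, nat \<Rightarrow> 'm) rmodule" where
  "V \<equiv> inv_poly_module R \<sigma> \<delta> A \<iota> x M"

abbreviation scalar :: "(nat \<Rightarrow> 'm) \<Rightarrow> 'r \<Rightarrow> nat \<Rightarrow> 'm" where
  "scalar \<equiv> inv_poly_scalar R \<sigma> \<delta> M"

abbreviation const :: "'m \<Rightarrow> nat \<Rightarrow> 'm" where
  "const m \<equiv> \<lambda>i. if i = 0 then m else \<zero>\<^bsub>M\<^esub>"

abbreviation monomial :: "'r \<Rightarrow> nat \<Rightarrow> 'a" where
  "monomial r k \<equiv> ore_poly R A \<iota> x (\<lambda>j. if j = k then r else \<zero>\<^bsub>R\<^esub>)"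

lemma sigma_hom: "\<sigma> \<in> ring_hom R R" and sigma_bij: "bij_betw \<sigma> (carrier R) (carrier R)"
  using sigma_iso by (auto simp: ring_iso_def)

lemma sigma'_closed: "r \<in> carrier R \<Longrightarrow> sigma' R \<sigma> r \<in> carrier R"
  using bij_betw_apply[OF bij_betw_inv_into[OF sigma_bij]] by (simp add: sigma'_def)

lemma sigma'_sigma: "r \<in> carrier R \<Longrightarrow> sigma' R \<sigma> (\<sigma> r) = r"
  using bij_betw_inv_into_left[OF sigma_bij] by (simp add: sigma'_def)

lemma sigma'_zero: "sigma' R \<sigma> \<zero>\<^bsub>R\<^esub> = \<zero>\<^bsub>R\<^esub>"
  using sigma'_sigma[of "\<zero>\<^bsub>R\<^esub>"] ring_hom_zero[OF sigma_hom] R.ring_axioms by simp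

lemma sigma'_one: "sigma' R \<sigma> \<one>\<^bsub>R\<^esub> = \<one>\<^bsub>R\<^esub>"
  using sigma'_sigma[of "\<one>\<^bsub>R\<^esub>"] ring_hom_one[OF sigma_hom] by simp

lemma delta_closed: "r \<in> carrier R \<Longrightarrow> \<delta> r \<in> carrier R"
  using deriv by (auto simp: sigma_derivation_def)

lemma delta_zero: "\<delta> \<zero>\<^bsub>R\<^esub> = \<zero>\<^bsub>R\<^esub>"
proof -
  have "\<delta> (\<zero>\<^bsub>R\<^esub> \<oplus>\<^bsub>R\<^esub> \<zero>\<^bsub>R\<^esub>) = \<delta> \<zero>\<^bsub>R\<^esub> \<oplus>\<^bsub>R\<^esub> \<delta> \<zero>\<^bsub>R\<^esub>"
    using deriv R.zero_closed unfolding sigma_derivation_def by blast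
  then show ?thesis
    using R.add.l_cancel_one'[of "\<delta> \<zero>\<^bsub>R\<^esub>" "\<delta> \<zero>\<^bsub>R\<^esub>"] delta_closed by simp
qed

lemma delta_one: "\<delta> \<one>\<^bsub>R\<^esub> = \<zero>\<^bsub>R\<^esub>"
proof -
  have "\<delta> (\<one>\<^bsub>R\<^esub> \<otimes>\<^bsub>R\<^esub> \<one>\<^bsub>R\<^esub>) = \<sigma> \<one>\<^bsub>R\<^esub> \<otimes>\<^bsub>R\<^esub> \<delta> \<one>\<^bsub>R\<^esub> \<oplus>\<^bsub>R\<^esub> \<delta> \<one>\<^bsub>R\<^esub> \<otimes>\<^bsub>R\<^esub> \<one>\<^bsub>R\<^esub>"
    using deriv R.one_closed unfolding sigma_derivation_def by blast
  then have "\<delta> \<one>\<^bsub>R\<^esub> = \<delta> \<one>\<^bsub>R\<^esub> \<oplus>\<^bsub>R\<^esub> \<delta> \<one>\<^bsub>R\<^esub>"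
    using delta_closed ring_hom_one[OF sigma_hom] by simp
  then show ?thesis
    using R.add.l_cancel_one'[of "\<delta> \<one>\<^bsub>R\<^esub>" "\<delta> \<one>\<^bsub>R\<^esub>"] delta_closed by simp
qed

lemma word_map_closed:
  "r \<in> carrier R \<Longrightarrow> word_map (sigma' R \<sigma>) (delta' R \<sigma> \<delta>) w r \<in> carrier R"
  by (induction w) (auto simp: delta'_def sigma'_closed delta_closed)

lemma word_map_zero: "word_map (sigma' R \<sigma>) (delta' R \<sigma> \<delta>) w \<zero>\<^bsub>R\<^esub> = \<zero>\<^bsub>R\<^esub>"
  by (induction w) (auto simp: delta'_def sigma'_zero delta_zero)

lemma word_map_one:
  "word_map (sigma' R \<sigma>) (delta' R \<sigma> \<delta>) w \<one>\<^bsub>R\<^esub> = (if False \<in> set w then \<zero>\<^bsub>R\<^esub> else \<one>\<^bsub>R\<^esub>)"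
  by (induction w) (auto simp: delta'_def sigma'_zero sigma'_one delta_zero delta_one)

lemma word_sum_closed: "r \<in> carrier R \<Longrightarrow> word_sum R \<sigma> \<delta> k i r \<in> carrier R"
  unfolding word_sum_def by (intro R.finsum_closed) (auto simp: word_map_closed)

lemma word_sum_diag:
  assumes "r \<in> carrier R"
  shows "word_sum R \<sigma> \<delta> k k r = (sigma' R \<sigma> ^^ k) r"
proof -
  have words: "{w. length w = k \<and> count_list w True = k} = {replicate k True}"
  proof (intro equalityI subsetI)
    fix w assume "w \<in> {w. length w = k \<and> count_list w True = k}"
    then have "length w = k" "False \<notin> set w"
      using count_list_True_eq_length_iff[of w] by auto
    then have "w = replicate k True"
      by (metis (full_types) replicate_eqI)
    then show "w \<in> {replicate k True}" by simp
  qed (use count_list_True_eq_length_iff[of "replicate k True"] in simp)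
  have "word_map s d (replicate k True) r = (s ^^ k) r" for s d :: "'r \<Rightarrow> 'r"
    by (induction k) auto
  then show ?thesis
    using word_map_closed[OF assms, of "replicate k True"] by (simp add: word_sum_def words)
qed

lemma word_sum_zero: "word_sum R \<sigma> \<delta> k i \<zero>\<^bsub>R\<^esub> = \<zero>\<^bsub>R\<^esub>"
  by (simp add: word_sum_def word_map_zero)

lemma word_sum_one: "word_sum R \<sigma> \<delta> k i \<one>\<^bsub>R\<^esub> = (if i = k then \<one>\<^bsub>R\<^esub> else \<zero>\<^bsub>R\<^esub>)"
proof (cases "i = k")
  case True
  have "(sigma' R \<sigma> ^^ k) \<one>\<^bsub>R\<^esub> = \<one>\<^bsub>R\<^esub>"
    by (induction k) (auto simp: sigma'_one)
  then show ?thesis using True word_sum_diag by simp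
next
  case False
  then have "False \<in> set w" if "length w = k" "count_list w True = i" for w
    using that count_list_True_eq_length_iff by metis
  then show ?thesis
    using False unfolding word_sum_def
    by (auto intro!: R.add.finprod_one_eqI simp: word_map_one)
qed

lemma sigma'_funpow_surj:
  "r \<in> carrier R \<Longrightarrow> \<exists>s\<in>carrier R. (sigma' R \<sigma> ^^ k) s = r"
proof (induction k)
  case (Suc k)
  then obtain s where s: "s \<in> carrier R" "(sigma' R \<sigma> ^^ k) s = r" by blast
  then have "(sigma' R \<sigma> ^^ Suc k) (\<sigma> s) = r"
    by (simp add: funpow_swap1 sigma'_sigma)
  then show ?case using s(1) sigma_hom by (auto simp: ring_hom_def)
qed auto

lemma up_coeff: "v \<in> up M \<Longrightarrow> v i \<in> carrier M"
  by (auto simp: up_def)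

lemma monomial_in_up: "r \<in> carrier R \<Longrightarrow> (\<lambda>j. if j = k then r else \<zero>\<^bsub>R\<^esub>) \<in> up R"
  by (auto simp: up_def bound_def intro!: exI[of _ k])

lemma const_in_up: "m \<in> carrier M \<Longrightarrow> const m \<in> up M"
  by (auto simp: up_def bound_def intro!: exI[of _ 0])

lemma ore_poly_closed:
  assumes "c \<in> up R"
  shows "ore_poly R A \<iota> x c \<in> carrier A"
proof -
  interpret A: ring A using ore by (simp add: skew_ore_ring_def)
  have "\<iota> (c j) \<in> carrier A" for j
    using ore assms by (auto simp: skew_ore_ring_def up_def ring_hom_def)
  moreover have "x \<in> carrier A"
    using ore by (simp add: skew_ore_ring_def)
  ultimately show ?thesis
    unfolding ore_poly_def by (intro A.finsum_closed) auto
qed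

lemma ore_coeffs_ore_poly:
  assumes "c \<in> up R"
  shows "ore_coeffs R A \<iota> x (ore_poly R A \<iota> x c) = c"
proof -
  have "\<exists>!d. d \<in> up R \<and> ore_poly R A \<iota> x c = ore_poly R A \<iota> x d"
    using ore ore_poly_closed[OF assms] unfolding skew_ore_ring_def by blast
  then show ?thesis
    unfolding ore_coeffs_def by (rule the1_equality) (simp add: assms)
qed

lemma ore_coeffs_in_up:
  assumes "a \<in> carrier A"
  shows "ore_coeffs R A \<iota> x a \<in> up R"
proof -
  have "\<exists>!d. d \<in> up R \<and> a = ore_poly R A \<iota> x d"
    using ore assms unfolding skew_ore_ring_def by blast
  from theI'[OF this] show ?thesis unfolding ore_coeffs_def by blast
qed

lemma scalar_closed:
  assumes "v \<in> up M" "r \<in> carrier R"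
  shows "scalar v r i \<in> carrier M"
  unfolding inv_poly_scalar_def using up_coeff[OF assms(1)] word_sum_closed[OF assms(2)]
  by (intro M.finsum_closed) (auto simp: act_closed)

lemma scalar_zero:
  assumes "v \<in> up M"
  shows "scalar v \<zero>\<^bsub>R\<^esub> i = \<zero>\<^bsub>M\<^esub>"
  unfolding inv_poly_scalar_def
  using up_coeff[OF assms] by (intro M.add.finprod_one_eqI) (simp add: word_sum_zero act_zero)

lemma scalar_single:
  assumes "v \<in> up M" "r \<in> carrier R" "\<And>k. i < k \<Longrightarrow> v k = \<zero>\<^bsub>M\<^esub>"
  shows "scalar v r i = v i \<triangleleft>\<^bsub>M\<^esub> word_sum R \<sigma> \<delta> i i r"
proof -
  have "{k. i \<le> k \<and> v k \<noteq> \<zero>\<^bsub>M\<^esub>} = (if v i = \<zero>\<^bsub>M\<^esub> then {} else {i})"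
    using assms(3) by (auto simp: le_less)
  then show ?thesis
    using up_coeff[OF assms(1), of i] word_sum_closed[OF assms(2), of i i]
    by (simp add: inv_poly_scalar_def zero_act act_closed)
qed

lemma scalar_one:
  assumes "v \<in> up M"
  shows "scalar v \<one>\<^bsub>R\<^esub> i = v i"
proof -
  have "scalar v \<one>\<^bsub>R\<^esub> i =
      (\<Oplus>\<^bsub>M\<^esub>k\<in>{k. i \<le> k \<and> v k \<noteq> \<zero>\<^bsub>M\<^esub>}. if i = k then v k else \<zero>\<^bsub>M\<^esub>)"
    unfolding inv_poly_scalar_def
    using up_coeff[OF assms] by (intro M.finsum_cong') (auto simp: word_sum_one act_one act_zero)
  also have "\<dots> = v i"
  proof (cases "v i = \<zero>\<^bsub>M\<^esub>")
    case True
    then show ?thesis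
      by (auto intro!: M.add.finprod_one_eqI)
  next
    case False
    moreover have "finite {k. i \<le> k \<and> v k \<noteq> \<zero>\<^bsub>M\<^esub>}"
      using up_finite[OF assms] by (rule rev_finite_subset) auto
    ultimately show ?thesis
      using up_coeff[OF assms] by (intro M.finsum_singleton) auto
  qed
  finally show ?thesis .
qed

lemma act_monomial:
  assumes "v \<in> up M" "r \<in> carrier R"
  shows "v \<triangleleft>\<^bsub>V\<^esub> monomial r k = (\<lambda>i. scalar v r (i + k))"
proof
  fix i
  have "{j. (if j = k then r else \<zero>\<^bsub>R\<^esub>) \<noteq> \<zero>\<^bsub>R\<^esub>} = (if r = \<zero>\<^bsub>R\<^esub> then {} else {k})"
    by auto
  then show "(v \<triangleleft>\<^bsub>V\<^esub> monomial r k) i = scalar v r (i + k)"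
    using scalar_closed[OF assms, of "i + k"] scalar_zero[OF assms(1), of "i + k"]
    by (simp add: inv_poly_module_def Let_def inv_poly_shift_def
        ore_coeffs_ore_poly[OF monomial_in_up[OF assms(2)]])
qed

lemma act_x:
  assumes "v \<in> up M"
  shows "v \<triangleleft>\<^bsub>V\<^esub> monomial \<one>\<^bsub>R\<^esub> 1 = (\<lambda>i. v (Suc i))"
  using act_monomial[OF assms, of "\<one>\<^bsub>R\<^esub>" 1] scalar_one[OF assms] by simp

lemma act_const:
  assumes "m \<in> carrier M" "a \<in> carrier A"
  shows "const m \<triangleleft>\<^bsub>V\<^esub> a = const (m \<triangleleft>\<^bsub>M\<^esub> ore_coeffs R A \<iota> x a 0)"
proof
  fix i
  define c where "c = ore_coeffs R A \<iota> x a"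
  have c: "c \<in> up R" using ore_coeffs_in_up[OF assms(2)] by (simp add: c_def)
  then have cR: "c j \<in> carrier R" for j by (auto simp: up_def)
  have scalar: "scalar (const m) r j = const (m \<triangleleft>\<^bsub>M\<^esub> r) j" if "r \<in> carrier R" for r j
    using scalar_single[OF const_in_up[OF assms(1)] that, of j] word_sum_closed[OF that]
      word_sum_diag[OF that, of 0]
    by (auto simp: zero_act)
  have "(const m \<triangleleft>\<^bsub>V\<^esub> a) i =
      (\<Oplus>\<^bsub>M\<^esub>j\<in>{j. c j \<noteq> \<zero>\<^bsub>R\<^esub>}. scalar (const m) (c j) (i + j))"
    by (simp add: inv_poly_module_def Let_def inv_poly_shift_def c_def)
  also have "\<dots> = (\<Oplus>\<^bsub>M\<^esub>j\<in>{j. c j \<noteq> \<zero>\<^bsub>R\<^esub>}. if 0 = j then const (m \<triangleleft>\<^bsub>M\<^esub> c 0) i else \<zero>\<^bsub>M\<^esub>)"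
    using assms(1) cR by (intro M.finsum_cong') (auto simp: scalar act_closed)
  also have "\<dots> = const (m \<triangleleft>\<^bsub>M\<^esub> c 0) i"
  proof (cases "c 0 = \<zero>\<^bsub>R\<^esub>")
    case True
    then show ?thesis
      using act_zero[OF assms(1)] by (auto intro!: M.add.finprod_one_eqI)
  next
    case False
    then show ?thesis
      using up_finite[OF c] assms(1) cR by (intro M.finsum_singleton) (auto simp: act_closed)
  qed
  finally show "(const m \<triangleleft>\<^bsub>V\<^esub> a) i = const (m \<triangleleft>\<^bsub>M\<^esub> ore_coeffs R A \<iota> x a 0) i"
    by (simp add: c_def)
qed

lemma carrier_V: "carrier V = up M"
  and zero_V: "\<zero>\<^bsub>V\<^esub> = (\<lambda>i. \<zero>\<^bsub>M\<^esub>)"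
  and add_V: "v \<oplus>\<^bsub>V\<^esub> w = (\<lambda>i. v i \<oplus>\<^bsub>M\<^esub> w i)"
  by (simp_all add: inv_poly_module_def)

lemma up_add:
  assumes "v \<in> up M" "w \<in> up M"
  shows "(\<lambda>i. v i \<oplus>\<^bsub>M\<^esub> w i) \<in> up M"
proof (rule mem_upI)
  obtain n k where n: "bound \<zero>\<^bsub>M\<^esub> n v" and k: "bound \<zero>\<^bsub>M\<^esub> k w"
    using assms unfolding up_def by blast
  have "bound \<zero>\<^bsub>M\<^esub> (max n k) (\<lambda>i. v i \<oplus>\<^bsub>M\<^esub> w i)"
    by (rule bound.intro) (simp add: bound.bound[OF n] bound.bound[OF k])
  then show "\<exists>n. bound \<zero>\<^bsub>M\<^esub> n (\<lambda>i. v i \<oplus>\<^bsub>M\<^esub> w i)" by (rule exI)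
  show "v i \<oplus>\<^bsub>M\<^esub> w i \<in> carrier M" for i
    using up_coeff[OF assms(1)] up_coeff[OF assms(2)] by simp
qed

lemma up_a_inv:
  assumes "v \<in> up M"
  shows "(\<lambda>i. \<ominus>\<^bsub>M\<^esub> v i) \<in> up M"
proof (rule mem_upI)
  obtain n where n: "bound \<zero>\<^bsub>M\<^esub> n v"
    using assms unfolding up_def by blast
  have "bound \<zero>\<^bsub>M\<^esub> n (\<lambda>i. \<ominus>\<^bsub>M\<^esub> v i)"
    by (rule bound.intro) (simp add: bound.bound[OF n])
  then show "\<exists>n. bound \<zero>\<^bsub>M\<^esub> n (\<lambda>i. \<ominus>\<^bsub>M\<^esub> v i)" by (rule exI)
  show "\<ominus>\<^bsub>M\<^esub> v i \<in> carrier M" for i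
    using up_coeff[OF assms] by simp
qed

lemma up_Suc:
  assumes "v \<in> up M"
  shows "(\<lambda>i. v (Suc i)) \<in> up M"
proof (rule mem_upI)
  obtain n where n: "bound \<zero>\<^bsub>M\<^esub> n v"
    using assms unfolding up_def by blast
  have "bound \<zero>\<^bsub>M\<^esub> n (\<lambda>i. v (Suc i))"
    by (rule bound.intro) (simp add: bound.bound[OF n])
  then show "\<exists>n. bound \<zero>\<^bsub>M\<^esub> n (\<lambda>i. v (Suc i))" by (rule exI)
  show "v (Suc i) \<in> carrier M" for i
    by (rule up_coeff[OF assms])
qed

lemma abelian_group_V: "abelian_group V"
proof (rule abelian_groupI; unfold carrier_V zero_V add_V)
  fix v assume v: "v \<in> up M"
  show "\<exists>w\<in>up M. (\<lambda>i. w i \<oplus>\<^bsub>M\<^esub> v i) = (\<lambda>i. \<zero>\<^bsub>M\<^esub>)"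
    using up_coeff[OF v] by (intro bexI[OF _ up_a_inv[OF v]]) (simp add: M.l_neg)
  show "(\<lambda>i. \<zero>\<^bsub>M\<^esub> \<oplus>\<^bsub>M\<^esub> v i) = v"
    using up_coeff[OF v] by simp
  fix w assume w: "w \<in> up M"
  show "(\<lambda>i. v i \<oplus>\<^bsub>M\<^esub> w i) \<in> up M"
    by (rule up_add[OF v w])
  show "(\<lambda>i. v i \<oplus>\<^bsub>M\<^esub> w i) = (\<lambda>i. w i \<oplus>\<^bsub>M\<^esub> v i)"
    using up_coeff[OF v] up_coeff[OF w] M.a_comm by simp
  fix u assume u: "u \<in> up M"
  show "(\<lambda>i. v i \<oplus>\<^bsub>M\<^esub> w i \<oplus>\<^bsub>M\<^esub> u i) = (\<lambda>i. v i \<oplus>\<^bsub>M\<^esub> (w i \<oplus>\<^bsub>M\<^esub> u i))"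
    using up_coeff[OF v] up_coeff[OF w] up_coeff[OF u] by (simp add: M.a_assoc)
next
  show "(\<lambda>i. \<zero>\<^bsub>M\<^esub>) \<in> up M"
    using const_in_up[OF M.zero_closed] by simp
qed

lemma top_coeff:
  assumes "v \<in> up M" "v \<noteq> (\<lambda>i. \<zero>\<^bsub>M\<^esub>)"
  obtains k where "v k \<noteq> \<zero>\<^bsub>M\<^esub>" "\<And>j. k < j \<Longrightarrow> v j = \<zero>\<^bsub>M\<^esub>"
proof
  let ?S = "{i. v i \<noteq> \<zero>\<^bsub>M\<^esub>}"
  have fin: "finite ?S" by (rule up_finite[OF assms(1)])
  have ne: "?S \<noteq> {}" using assms(2) by auto
  show "v (Max ?S) \<noteq> \<zero>\<^bsub>M\<^esub>" using Max_in[OF fin ne] by simp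
  show "v j = \<zero>\<^bsub>M\<^esub>" if "Max ?S < j" for j
    using that Max_ge[OF fin, of j] by auto
qed

lemma orbit_top_coeff:
  assumes "v \<in> up M" "\<And>j. k < j \<Longrightarrow> v j = \<zero>\<^bsub>M\<^esub>" "r \<in> carrier R"
  shows "\<exists>a\<in>carrier A. v \<triangleleft>\<^bsub>V\<^esub> a = const (v k \<triangleleft>\<^bsub>M\<^esub> r)"
proof -
  obtain s where s: "s \<in> carrier R" "(sigma' R \<sigma> ^^ k) s = r"
    using sigma'_funpow_surj[OF assms(3)] by blast
  have "scalar v s (i + k) = const (v k \<triangleleft>\<^bsub>M\<^esub> r) i" for i
    using scalar_single[OF assms(1) s(1), of "i + k"] assms(2) s(2) word_sum_closed[OF s(1)]
      word_sum_diag[OF s(1), of k]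
    by (auto simp: zero_act)
  then have "v \<triangleleft>\<^bsub>V\<^esub> monomial s k = const (v k \<triangleleft>\<^bsub>M\<^esub> r)"
    using act_monomial[OF assms(1) s(1)] by auto
  then show ?thesis using ore_poly_closed[OF monomial_in_up[OF s(1)]] by blast
qed

lemma essential_embedding_const: "essential_embedding R M A V const (monomial \<one>\<^bsub>R\<^esub> 1)"
proof (intro essential_embedding.intro essential_embedding_axioms.intro abelian_group_homI
    group_hom.intro group_hom_axioms.intro)
  show "right_module R M" by (rule right_module_axioms)
  show "abelian_group V" by (rule abelian_group_V)
  then show "Group.group (add_monoid V)" by (rule abelian_group.a_group)
  show "abelian_group M" by (rule M.abelian_group_axioms)
  then show "Group.group (add_monoid M)" by (rule abelian_group.a_group)
  show "const \<in> hom (add_monoid M) (add_monoid V)"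
    by (auto simp: hom_def carrier_V add_V const_in_up)
  show "(\<lambda>v. v \<triangleleft>\<^bsub>V\<^esub> monomial \<one>\<^bsub>R\<^esub> 1) \<in> hom (add_monoid V) (add_monoid V)"
    by (auto simp: hom_def carrier_V add_V act_x[simplified] up_add up_Suc)
  show "inj_on const (carrier M)"
    by (rule inj_onI) (metis (full_types))
  show "monomial \<one>\<^bsub>R\<^esub> 1 \<in> carrier A"
    by (rule ore_poly_closed[OF monomial_in_up[OF R.one_closed]])
  show "const m \<triangleleft>\<^bsub>V\<^esub> monomial \<one>\<^bsub>R\<^esub> 1 = \<zero>\<^bsub>V\<^esub>" if "m \<in> carrier M" for m
    using act_x[OF const_in_up[OF that]] by (simp add: zero_V)
  show "v \<in> const ` carrier M" if v: "v \<in> carrier V" "v \<triangleleft>\<^bsub>V\<^esub> monomial \<one>\<^bsub>R\<^esub> 1 = \<zero>\<^bsub>V\<^esub>" for v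
  proof -
    have "v (Suc i) = \<zero>\<^bsub>M\<^esub>" for i
      using v(2) act_x[of v] v(1) by (metis carrier_V zero_V)
    then have "v = const (v 0)" by (metis not0_implies_Suc)
    then show ?thesis using up_coeff[of v 0] v(1) by (auto simp: carrier_V)
  qed
  show "(\<lambda>a. const m \<triangleleft>\<^bsub>V\<^esub> a) ` carrier A = (\<lambda>r. const (m \<triangleleft>\<^bsub>M\<^esub> r)) ` carrier R"
    if m: "m \<in> carrier M" for m
  proof (intro equalityI subsetI)
    fix v assume "v \<in> (\<lambda>a. const m \<triangleleft>\<^bsub>V\<^esub> a) ` carrier A"
    then obtain a where a: "a \<in> carrier A" "v = const m \<triangleleft>\<^bsub>V\<^esub> a" by blast
    then have "ore_coeffs R A \<iota> x a 0 \<in> carrier R"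
      using ore_coeffs_in_up[OF a(1)] by (auto simp: up_def)
    then show "v \<in> (\<lambda>r. const (m \<triangleleft>\<^bsub>M\<^esub> r)) ` carrier R"
      using a act_const[OF m a(1)] by blast
  next
    fix v assume "v \<in> (\<lambda>r. const (m \<triangleleft>\<^bsub>M\<^esub> r)) ` carrier R"
    then obtain r where r: "r \<in> carrier R" "v = const (m \<triangleleft>\<^bsub>M\<^esub> r)" by blast
    have "monomial r 0 \<in> carrier A"
      by (rule ore_poly_closed[OF monomial_in_up[OF r(1)]])
    moreover have "ore_coeffs R A \<iota> x (monomial r 0) 0 = r"
      by (subst ore_coeffs_ore_poly[OF monomial_in_up[OF r(1)]]) simp
    then have "v = const m \<triangleleft>\<^bsub>V\<^esub> monomial r 0"
      using act_const[OF m calculation] r(2) by metis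
    ultimately show "v \<in> (\<lambda>a. const m \<triangleleft>\<^bsub>V\<^esub> a) ` carrier A" by blast
  qed
  show "\<exists>m\<in>carrier M. m \<noteq> \<zero>\<^bsub>M\<^esub> \<and>
      (\<forall>r\<in>carrier R. \<exists>a\<in>carrier A. v \<triangleleft>\<^bsub>V\<^esub> a = const (m \<triangleleft>\<^bsub>M\<^esub> r))"
    if v: "v \<in> carrier V" "v \<noteq> \<zero>\<^bsub>V\<^esub>" for v
  proof -
    have up: "v \<in> up M" "v \<noteq> (\<lambda>i. \<zero>\<^bsub>M\<^esub>)" using v by (simp_all add: carrier_V zero_V)
    obtain k where k: "v k \<noteq> \<zero>\<^bsub>M\<^esub>" "\<And>j. k < j \<Longrightarrow> v j = \<zero>\<^bsub>M\<^esub>"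
      by (rule top_coeff[OF up]) blast
    show ?thesis
      using up_coeff[OF up(1), of k] k(1) orbit_top_coeff[OF up(1) k(2)] by blast
  qed
qed (rule abelian_group_V abelian_group.a_group[OF abelian_group_V])+

end

theorem theorem3p3:
  fixes R :: "('r, 'p) ring_scheme"
    and \<sigma> \<delta> :: "'r \<Rightarrow> 'r"
    and A :: "('a, 'q) ring_scheme"
    and \<iota> :: "'r \<Rightarrow> 'a"
    and x :: 'a
    and M :: "('r, 'm, 's) rmodule_scheme"
  assumes "ring R"
    and "\<sigma> \<in> ring_iso R R"
    and "sigma_derivation R \<sigma> \<delta>"
    and "locally_nilpotent R \<delta>"
    and "skew_ore_ring R \<sigma> \<delta> A \<iota> x"
    and "right_module R M"
    and "completely_compatible R \<sigma> \<delta> M"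
  shows "rudim A (inv_poly_module R \<sigma> \<delta> A \<iota> x M) = rudim R M"
proof -
  interpret inverse_polynomials R M \<sigma> \<delta> A \<iota> x
    using assms by (simp add: inverse_polynomials_def inverse_polynomials_axioms_def)
  interpret essential_embedding R M A V const "monomial \<one>\<^bsub>R\<^esub> 1"
    by (rule essential_embedding_const)
  have "has_rudim A V = has_rudim R M"
    by (rule ext) (rule has_rudim_iff)
  then show ?thesis by (simp add: rudim_def)
qed

end
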